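(* Let $\alpha,\beta,\gamma\in(0,1)$ and, for $\bm x=(x_1,x_2,x_3)\in[0,\infty)^3$, let $$g(\bm x)=x_2+\left[\left\{\left(x_1^{1/\alpha}+x_2^{1/\alpha}\right)^\alpha-x_2\right\}^{1/\gamma}+\left\{\left(x_2^{1/\beta}+x_3^{1/\beta}\right)^\beta-x_2\right\}^{1/\gamma}\right]^\gamma,$$ the gauge function of the trivariate vine copula whose pair copulas $C_{12},C_{23},C_{13|2}$ are inverted logistic with parameters $\alpha,\beta,\gamma$ respectively. Then the coefficient of tail dependence $\eta_{\{1,2,3\}}=\left\{\min_{\bm x:\min(\bm x)\ge1}g(\bm x)\right\}^{-1}$ is $$\eta_{\{1,2,3\}}=g(1,1,1)^{-1}=\left[1+\left\{(2^\alpha-1)^{1/\gamma}+(2^\beta-1)^{1/\gamma}\right\}^\gamma\right]^{-1}.$$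
   Context: The inverted logistic copula is the inverted extreme value copula with exponent measure $V(x,y)=(x^{-1/\alpha}+y^{-1/\alpha})^\alpha$. The gauge function of a joint density $f$ with standard exponential margins is the function $g$, homogeneous of order 1, with $-\ln f(t\bm x)\sim tg(\bm x)$ as $t\to\infty$. The coefficient of tail dependence is taken in its gauge-function form $\eta_{\{1,2,3\}}=\{\min_{\bm x:\min(\bm x)\ge1}g(\bm x)\}^{-1}$. *)

theory Defs
  imports "HOL-Analysis.Analysis" "HOL-Library.Landau_Symbols"
begin

(* All copulas below are described on the open unit square; only values and
   derivatives there enter a density. *)

definition logistic_exponent :: "real \<Rightarrow> real \<Rightarrow> real \<Rightarrow> real" where
  "logistic_exponent \<alpha> x y = (x powr (-1/\<alpha>) + y powr (-1/\<alpha>)) powr \<alpha>"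

definition ev_copula :: "(real \<Rightarrow> real \<Rightarrow> real) \<Rightarrow> real \<Rightarrow> real \<Rightarrow> real" where
  "ev_copula V u v = exp (- V (-1 / ln u) (-1 / ln v))"

(* The joint distribution function of (1-U, 1-V) when (U, V) has the extreme value copula. *)
definition inverted_ev_copula :: "(real \<Rightarrow> real \<Rightarrow> real) \<Rightarrow> real \<Rightarrow> real \<Rightarrow> real" where
  "inverted_ev_copula V u v = u + v - 1 + ev_copula V (1 - u) (1 - v)"

definition inverted_logistic_copula :: "real \<Rightarrow> real \<Rightarrow> real \<Rightarrow> real" where
  "inverted_logistic_copula \<alpha> = inverted_ev_copula (logistic_exponent \<alpha>)"

definition copula_density :: "(real \<Rightarrow> real \<Rightarrow> real) \<Rightarrow> real \<Rightarrow> real \<Rightarrow> real" where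
  "copula_density C u v = deriv (\<lambda>a. deriv (\<lambda>b. C a b) v) u"

(* Conditional distribution function of the first (second) coordinate given the other one. *)
definition cond_fst :: "(real \<Rightarrow> real \<Rightarrow> real) \<Rightarrow> real \<Rightarrow> real \<Rightarrow> real" where
  "cond_fst C u v = deriv (\<lambda>b. C u b) v"

definition cond_snd :: "(real \<Rightarrow> real \<Rightarrow> real) \<Rightarrow> real \<Rightarrow> real \<Rightarrow> real" where
  "cond_snd C u v = deriv (\<lambda>a. C a v) u"

(* C13 is the copula of (U1, U3) conditional on U2, the same for every value of U2
   (the simplifying assumption of the pair copula construction). *)
definition vine_copula_density ::
  "(real \<Rightarrow> real \<Rightarrow> real) \<Rightarrow> (real \<Rightarrow> real \<Rightarrow> real) \<Rightarrow> (real \<Rightarrow> real \<Rightarrow> real) \<Rightarrow>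
   real \<Rightarrow> real \<Rightarrow> real \<Rightarrow> real" where
  "vine_copula_density C12 C23 C13 u1 u2 u3 =
     copula_density C12 u1 u2 * copula_density C23 u2 u3 *
     copula_density C13 (cond_fst C12 u1 u2) (cond_snd C23 u2 u3)"

(* The joint density on the positive orthant with copula density c and standard
   exponential margins. *)
definition exp_margins_density ::
  "(real \<Rightarrow> real \<Rightarrow> real \<Rightarrow> real) \<Rightarrow> real^3 \<Rightarrow> real" where
  "exp_margins_density c x =
     c (1 - exp (- x $ 1)) (1 - exp (- x $ 2)) (1 - exp (- x $ 3)) *
     (exp (- x $ 1) * exp (- x $ 2) * exp (- x $ 3))"

(* The density may vanish on the boundary of the orthant, so the limit relation is
   required in the interior and g is determined on the boundary by continuity.
   Positivity of f is explicit because ln is total. *)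
definition is_gauge_function :: "(real^3 \<Rightarrow> real) \<Rightarrow> (real^3 \<Rightarrow> real) \<Rightarrow> bool" where
  "is_gauge_function f g \<longleftrightarrow>
     continuous_on {x. \<forall>i. 0 \<le> x $ i} g \<and>
     (\<forall>x t. (\<forall>i. 0 \<le> x $ i) \<longrightarrow> 0 < t \<longrightarrow> g (t *\<^sub>R x) = t * g x) \<and>
     (\<forall>x. (\<forall>i. 0 < x $ i) \<longrightarrow>
        (\<forall>\<^sub>F t in at_top. 0 < f (t *\<^sub>R x)) \<and>
        (\<lambda>t. - ln (f (t *\<^sub>R x))) \<sim>[at_top] (\<lambda>t. t * g x))"

(* Meaningful when the minimum is attained. *)
definition tail_dependence_coeff :: "(real^3 \<Rightarrow> real) \<Rightarrow> real" where
  "tail_dependence_coeff g = inverse (LEAST m. m \<in> g ` {x. (MIN i. x $ i) \<ge> 1})"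

end

theory Submission imports Defs begin

text \<open>
  Write \<open>N\<^sub>\<alpha>(a, b) = (a\<^sup>p + b\<^sup>p)\<^sup>\<alpha>\<close> with \<open>p = 1/\<alpha> > 1\<close>: the \<open>\<ell>\<^sup>p\<close> norm on the positive quadrant.
  In exponential coordinates \<open>u = 1 - exp (-a)\<close>, \<open>v = 1 - exp (-b)\<close> the joint survival function
  of the inverted logistic copula is \<open>exp (-N\<^sub>\<alpha>(a, b))\<close>.

  \<^emph>\<open>Gauge function.\<close> Differentiating twice, the log density of the copula is
  \<open>a + b - N\<^sub>\<alpha>(a, b)\<close> plus logarithmic terms. If \<open>a\<close> and \<open>b\<close> grow linearly in \<open>t\<close>, the logarithmic
  terms are \<open>o(t)\<close> and the rest is homogeneous of order 1 (lemma \<open>logistic_log_density_rate\<close>).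
  Conditioning preserves linear growth: the conditional distribution function of \<open>U\<^sub>1\<close> given \<open>U\<^sub>2\<close>,
  read in exponential coordinates, is \<open>N\<^sub>\<alpha>(a, b) - b\<close> up to a term which is constant along rays
  (lemmas \<open>cond_fst_inverted_logistic_exp\<close> and \<open>logistic_cond_exp_rate\<close>). So one rate lemma covers
  all three pair copulas. With \<open>A = N\<^sub>\<alpha>(x\<^sub>1, x\<^sub>2) - x\<^sub>2\<close> and \<open>B = N\<^sub>\<beta>(x\<^sub>2, x\<^sub>3) - x\<^sub>2\<close>, adding their
  rates to those of the exponential margins cancels everything except \<open>x\<^sub>2 + N\<^sub>\<gamma>(A, B)\<close>.

  \<^emph>\<open>Minimum.\<close> The function \<open>g\<close> increases in \<open>x\<^sub>1\<close> and \<open>x\<^sub>3\<close>, so these can be set to 1. Raising \<open>x\<^sub>2\<close>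
  from 1 to \<open>s\<close> adds \<open>s - 1\<close> to the first summand but decreases \<open>A\<close> and \<open>B\<close>. Each of them
  drops by at most \<open>(s - 1)/2\<close>, because the slope of the norm at \<open>(1, 1)\<close> is \<open>2 powr (\<alpha> - 1)\<close>, which
  exceeds \<open>1/2\<close>, and the norm lies above its tangent there (lemma \<open>logistic_norm_growth\<close>).
  Since \<open>N\<^sub>\<gamma>\<close> is 1-Lipschitz in each argument (lemma \<open>logistic_norm_add_le\<close>), it loses at most
  \<open>s - 1\<close> in total, which the first summand makes up for.
\<close>

section \<open>The logistic norm and its partial derivatives\<close>

definition logistic_norm :: "real \<Rightarrow> real \<Rightarrow> real \<Rightarrow> real" where
  "logistic_norm \<alpha> a b = (a powr (1/\<alpha>) + b powr (1/\<alpha>)) powr \<alpha>"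

text \<open>The partial derivative of the norm in its first argument.\<close>

definition logistic_slope :: "real \<Rightarrow> real \<Rightarrow> real \<Rightarrow> real" where
  "logistic_slope \<alpha> a b = a powr (1/\<alpha> - 1) * (a powr (1/\<alpha>) + b powr (1/\<alpha>)) powr (\<alpha> - 1)"

lemma logistic_norm_commute: "logistic_norm \<alpha> a b = logistic_norm \<alpha> b a"
  by (simp add: logistic_norm_def add.commute)

lemma logistic_norm_pos:
  assumes "0 < a" "0 < b"
  shows "0 < logistic_norm \<alpha> a b"
proof -
  have "0 < a powr (1/\<alpha>) + b powr (1/\<alpha>)" using assms by (intro add_pos_pos) auto
  then show ?thesis by (simp add: logistic_norm_def)
qed

lemma logistic_norm_scale:
  assumes "\<alpha> > 0" "t > 0" "0 \<le> a" "0 \<le> b"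
  shows "logistic_norm \<alpha> (t * a) (t * b) = t * logistic_norm \<alpha> a b"
proof -
  have "logistic_norm \<alpha> (t * a) (t * b) = (t powr (1/\<alpha>) * (a powr (1/\<alpha>) + b powr (1/\<alpha>))) powr \<alpha>"
    using assms by (simp add: logistic_norm_def powr_mult distrib_left)
  also have "\<dots> = t * logistic_norm \<alpha> a b"
    using assms by (simp add: logistic_norm_def powr_mult powr_powr)
  finally show ?thesis .
qed

lemma logistic_slope_scale:
  assumes "\<alpha> > 0" "t > 0" "0 < a" "0 < b"
  shows "logistic_slope \<alpha> (t * a) (t * b) = logistic_slope \<alpha> a b"
proof -
  have "logistic_slope \<alpha> (t * a) (t * b) =
     (t powr (1/\<alpha> - 1) * a powr (1/\<alpha> - 1)) * (t powr (1/\<alpha>) * (a powr (1/\<alpha>) + b powr (1/\<alpha>))) powr (\<alpha> - 1)"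
    using assms by (simp add: logistic_slope_def powr_mult distrib_left)
  also have "\<dots> = (t powr (1/\<alpha> - 1) * t powr ((1/\<alpha>) * (\<alpha> - 1))) * logistic_slope \<alpha> a b"
    using assms by (simp add: logistic_slope_def powr_mult powr_powr)
  also have "t powr (1/\<alpha> - 1) * t powr ((1/\<alpha>) * (\<alpha> - 1)) = 1"
    using assms by (simp add: powr_add[symmetric] field_simps)
  finally show ?thesis by simp
qed

lemma logistic_norm_mono:
  assumes "\<alpha> > 0" "0 \<le> a" "a \<le> a'" "0 \<le> b" "b \<le> b'"
  shows "logistic_norm \<alpha> a b \<le> logistic_norm \<alpha> a' b'"
  unfolding logistic_norm_def using assms
  by (intro powr_mono2 add_mono) auto

lemma logistic_norm_ge_snd:
  assumes "\<alpha> > 0" "0 \<le> a" "0 \<le> b"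
  shows "b \<le> logistic_norm \<alpha> a b"
proof -
  have "b = (b powr (1/\<alpha>)) powr \<alpha>" using assms by (simp add: powr_powr)
  also have "\<dots> \<le> logistic_norm \<alpha> a b"
    unfolding logistic_norm_def using assms by (intro powr_mono2) auto
  finally show ?thesis .
qed

lemma logistic_norm_gt_snd:
  assumes "\<alpha> > 0" "0 < a" "0 < b"
  shows "b < logistic_norm \<alpha> a b"
proof -
  have "b = (b powr (1/\<alpha>)) powr \<alpha>" using assms by (simp add: powr_powr)
  also have "\<dots> < logistic_norm \<alpha> a b"
    unfolding logistic_norm_def using assms by (intro powr_less_mono2) auto
  finally show ?thesis .
qed

lemma logistic_slope_pos:
  assumes "0 < a" "0 < b"
  shows "0 < logistic_slope \<alpha> a b"
proof -
  have "0 < a powr (1/\<alpha>) + b powr (1/\<alpha>)" using assms by (intro add_pos_pos) auto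
  then show ?thesis using assms by (simp add: logistic_slope_def)
qed

text \<open>Dropping \<open>b\<close> from the sum raises its negative power, and leaves exactly 1. Thus the norm
  grows at most at unit rate in each argument, and conditional distribution functions stay
  inside the unit interval.\<close>

lemma logistic_slope_less_1:
  assumes "\<alpha> \<in> {0<..<1}" "0 < a" "0 < b"
  shows "logistic_slope \<alpha> a b < 1"
proof -
  let ?S = "a powr (1/\<alpha>) + b powr (1/\<alpha>)"
  have "?S powr (\<alpha> - 1) < (a powr (1/\<alpha>)) powr (\<alpha> - 1)"
    using assms by (intro powr_less_mono2_neg) auto
  also have "\<dots> = a powr (1 - 1/\<alpha>)"
    using assms by (simp add: powr_powr field_simps)
  finally have "logistic_slope \<alpha> a b < a powr (1/\<alpha> - 1) * a powr (1 - 1/\<alpha>)"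
    using assms by (simp add: logistic_slope_def)
  also have "\<dots> = 1" using assms by (simp add: powr_add[symmetric])
  finally show ?thesis .
qed

lemma has_real_derivative_logistic_norm:
  assumes "\<alpha> > 0" "0 < a" "0 < b"
  shows "((\<lambda>a. logistic_norm \<alpha> a b) has_real_derivative logistic_slope \<alpha> a b) (at a within X)"
proof -
  have "0 < a powr (1/\<alpha>) + b powr (1/\<alpha>)" using assms by (intro add_pos_pos) auto
  then show ?thesis
    unfolding logistic_norm_def logistic_slope_def using assms
    by (auto intro!: derivative_eq_intros simp: powr_diff field_simps)
qed

text \<open>The mixed second derivative of the norm. Its last factor is a power of the norm, not of the sum
  \<open>a powr (1/\<alpha>) + b powr (1/\<alpha>)\<close>, so that the density below depends on that sum only through the norm,
  whose growth along rays is known.\<close>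

lemma has_real_derivative_logistic_slope:
  assumes "\<alpha> > 0" "0 < a" "0 < b"
  shows "((\<lambda>a. logistic_slope \<alpha> b a) has_real_derivative
    - ((1 - \<alpha>) / \<alpha> * (a powr (1/\<alpha> - 1) * b powr (1/\<alpha> - 1) * logistic_norm \<alpha> a b powr (1 - 2/\<alpha>)))) (at a)"
proof -
  have S: "a powr (1/\<alpha>) + b powr (1/\<alpha>) > 0" using assms by (simp add: add_pos_pos)
  have norm_powr: "logistic_norm \<alpha> a b powr (1 - 2/\<alpha>) = (a powr (1/\<alpha>) + b powr (1/\<alpha>)) powr (\<alpha> - 2)"
    using assms by (simp add: logistic_norm_def powr_powr right_diff_distrib)
  have inner: "((\<lambda>x. b powr (1/\<alpha>) + x powr (1/\<alpha>)) has_real_derivative 1/\<alpha> * a powr (1/\<alpha> - 1)) (at a)"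
    using assms by (auto intro!: derivative_eq_intros)
  have outer: "((\<lambda>s. s powr (\<alpha> - 1)) has_real_derivative
      (\<alpha> - 1) * (b powr (1/\<alpha>) + a powr (1/\<alpha>)) powr (\<alpha> - 1 - 1)) (at (b powr (1/\<alpha>) + a powr (1/\<alpha>)))"
    using S by (intro has_real_derivative_powr) (simp add: add.commute)
  from DERIV_cmult[OF DERIV_chain2[OF outer inner], of "b powr (1/\<alpha> - 1)"]
  show ?thesis
    unfolding logistic_slope_def norm_powr
    by (rule DERIV_cong) (use assms in \<open>simp add: add.commute field_simps\<close>)
qed

lemma tendsto_logistic_norm:
  assumes "\<alpha> > 0" "0 < a" "0 < b" "(A \<longlongrightarrow> a) F" "(B \<longlongrightarrow> b) F"
  shows "((\<lambda>t. logistic_norm \<alpha> (A t) (B t)) \<longlongrightarrow> logistic_norm \<alpha> a b) F"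
  unfolding logistic_norm_def using assms
  by (intro tendsto_powr tendsto_add tendsto_const) (auto simp: add_pos_pos dest: add_nonneg_eq_0_iff[THEN iffD1, rotated 2])

section \<open>The minimum of the gauge function\<close>

lemma logistic_norm_add_le:
  assumes "\<alpha> \<in> {0<..<1}" "0 < a" "0 < b" "0 \<le> d"
  shows "logistic_norm \<alpha> (a + d) b \<le> logistic_norm \<alpha> a b + d"
proof -
  have "logistic_norm \<alpha> (a + d) b - (a + d) \<le> logistic_norm \<alpha> a b - a"
  proof (rule DERIV_nonpos_imp_nonincreasing[where f = "\<lambda>a. logistic_norm \<alpha> a b - a"])
    show "a \<le> a + d" using assms by simp
    fix x assume "a \<le> x" "x \<le> a + d"
    then have "x > 0" using assms by simp
    then have "((\<lambda>a. logistic_norm \<alpha> a b - a) has_real_derivative logistic_slope \<alpha> x b - 1) (at x)"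
      using assms by (auto intro!: derivative_eq_intros has_real_derivative_logistic_norm)
    then show "\<exists>y. ((\<lambda>a. logistic_norm \<alpha> a b - a) has_real_derivative y) (at x) \<and> y \<le> 0"
      using logistic_slope_less_1[of \<alpha> x b] assms \<open>x > 0\<close> by (intro exI[of _ "logistic_slope \<alpha> x b - 1"]) auto
  qed
  then show ?thesis by simp
qed

text \<open>The power mean inequality, that is, convexity of \<open>x powr (1/\<alpha>)\<close>. The linear function on the left
  is the tangent to the norm along the diagonal.\<close>

lemma logistic_norm_tangent:
  assumes "\<alpha> \<in> {0<..<1}" "0 < a" "0 < b"
  shows "2 powr \<alpha> * ((a + b) / 2) \<le> logistic_norm \<alpha> a b"
proof -
  let ?p = "1/\<alpha>"
  have "convex_on {0<..} (\<lambda>x::real. x powr ?p)"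
    using assms by (intro powr_convex) auto
  then have "((a + b)/2) powr ?p \<le> (a powr ?p + b powr ?p) / 2"
    using convex_onD[of "{0<..}" "\<lambda>x::real. x powr ?p" "1/2" a b] assms
    by (simp add: add_divide_distrib)
  then have "2 * ((a + b)/2) powr ?p \<le> a powr ?p + b powr ?p"
    by simp
  then have "(2 * ((a + b)/2) powr ?p) powr \<alpha> \<le> logistic_norm \<alpha> a b"
    unfolding logistic_norm_def using assms by (intro powr_mono2) auto
  then show ?thesis using assms by (simp add: powr_mult powr_powr)
qed

lemma logistic_norm_1_1: "logistic_norm \<alpha> 1 1 = 2 powr \<alpha>"
  by (simp add: logistic_norm_def)

lemma logistic_norm_growth:
  assumes "\<alpha> \<in> {0<..<1}" "1 \<le> s"
  shows "2 powr \<alpha> + (s - 1) / 2 \<le> logistic_norm \<alpha> 1 s"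
proof -
  have "1 \<le> 2 powr \<alpha>" using assms ge_one_powr_ge_zero by auto
  then have "(s - 1) / 2 \<le> 2 powr \<alpha> * ((s - 1) / 2)"
    using assms mult_right_mono[of 1 "2 powr \<alpha>" "(s - 1)/2"] by simp
  moreover have "2 powr \<alpha> * ((1 + s) / 2) \<le> logistic_norm \<alpha> 1 s"
    using assms by (intro logistic_norm_tangent) auto
  moreover have "2 powr \<alpha> * ((1 + s) / 2) = 2 powr \<alpha> + 2 powr \<alpha> * ((s - 1) / 2)"
    by (simp add: field_simps)
  ultimately show ?thesis by linarith
qed

text \<open>The step from 1 to \<open>s\<close> is split evenly: \<open>d = (s - 1) / 2\<close> bounds the drop of each argument of
  the outer norm.\<close>

lemma gauge_min_bound:
  assumes "\<alpha> \<in> {0<..<1}" "\<beta> \<in> {0<..<1}" "\<gamma> \<in> {0<..<1}" "1 \<le> x" "1 \<le> s" "1 \<le> z"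
  shows "1 + logistic_norm \<gamma> (2 powr \<alpha> - 1) (2 powr \<beta> - 1)
     \<le> s + logistic_norm \<gamma> (logistic_norm \<alpha> x s - s) (logistic_norm \<beta> z s - s)"
proof -
  define A where "A = logistic_norm \<alpha> 1 s - s"
  define B where "B = logistic_norm \<beta> 1 s - s"
  define d where "d = (s - 1) / 2"
  have pos: "A > 0" "B > 0" "d \<ge> 0"
    using assms logistic_norm_gt_snd[of \<alpha> 1 s] logistic_norm_gt_snd[of \<beta> 1 s]
    by (auto simp: A_def B_def d_def)
  have *: "1 \<le> 2 powr \<alpha>" "1 \<le> 2 powr \<beta>" using assms ge_one_powr_ge_zero by auto
  have "2 powr \<alpha> - 1 \<le> A + d" "2 powr \<beta> - 1 \<le> B + d"
    using logistic_norm_growth[of \<alpha> s] logistic_norm_growth[of \<beta> s] assms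
    by (auto simp: A_def B_def d_def field_simps)
  then have "logistic_norm \<gamma> (2 powr \<alpha> - 1) (2 powr \<beta> - 1) \<le> logistic_norm \<gamma> (A + d) (B + d)"
    using * assms by (intro logistic_norm_mono) auto
  also have "\<dots> \<le> logistic_norm \<gamma> A (B + d) + d"
    using assms pos by (intro logistic_norm_add_le) auto
  also have "logistic_norm \<gamma> A (B + d) \<le> logistic_norm \<gamma> A B + d"
    using logistic_norm_add_le[of \<gamma> B A d] assms pos by (simp add: logistic_norm_commute)
  also have "logistic_norm \<gamma> A B \<le> logistic_norm \<gamma> (logistic_norm \<alpha> x s - s) (logistic_norm \<beta> z s - s)"
    using assms pos logistic_norm_mono[of \<alpha> 1 x s s] logistic_norm_mono[of \<beta> 1 z s s]
    by (intro logistic_norm_mono) (auto simp: A_def B_def)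
  finally show ?thesis by (simp add: d_def)
qed

section \<open>The inverted logistic copula in exponential coordinates\<close>

lemma inverted_logistic_copula_commute:
  "inverted_logistic_copula \<alpha> u v = inverted_logistic_copula \<alpha> v u"
  by (simp add: inverted_logistic_copula_def inverted_ev_copula_def ev_copula_def
      logistic_exponent_def add.commute)

lemma inverted_logistic_copula_eq:
  assumes "u \<in> {0<..<1}" "v \<in> {0<..<1}"
  shows "inverted_logistic_copula \<alpha> u v =
    u + v - 1 + exp (- logistic_norm \<alpha> (- ln (1 - u)) (- ln (1 - v)))"
proof -
  have *: "(-1 / ln (1 - w)) powr (-1/\<alpha>) = (- ln (1 - w)) powr (1/\<alpha>)" if "w \<in> {0<..<1}" for w :: real
  proof -
    have "- ln (1 - w) > 0" using that by simp
    moreover have "-1 / ln (1 - w) = inverse (- ln (1 - w))" by (simp add: field_simps)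
    ultimately show ?thesis
      by (metis inverse_powr less_imp_le minus_divide_left powr_minus inverse_inverse_eq)
  qed
  show ?thesis
    using *[OF assms(1)] *[OF assms(2)]
    by (simp add: inverted_logistic_copula_def inverted_ev_copula_def ev_copula_def
        logistic_exponent_def logistic_norm_def)
qed

lemma cond_fst_inverted_logistic:
  assumes "\<alpha> > 0" "u \<in> {0<..<1}" "v \<in> {0<..<1}"
  shows "cond_fst (inverted_logistic_copula \<alpha>) u v =
    1 - exp (- logistic_norm \<alpha> (- ln (1 - u)) (- ln (1 - v))) *
        logistic_slope \<alpha> (- ln (1 - v)) (- ln (1 - u)) / (1 - v)"
proof -
  let ?a = "- ln (1 - u)" and ?b = "- ln (1 - v)"
  have pos: "?a > 0" "?b > 0" using assms by auto
  have "((\<lambda>w. - ln (1 - w)) has_real_derivative 1 / (1 - v)) (at v)"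
    using assms by (auto intro!: derivative_eq_intros simp: field_simps)
  from DERIV_chain2[OF has_real_derivative_logistic_norm[OF assms(1) pos(2,1)] this]
  have "((\<lambda>w. logistic_norm \<alpha> ?a (- ln (1 - w))) has_real_derivative
      logistic_slope \<alpha> ?b ?a * (1 / (1 - v))) (at v)"
    by (subst (asm) logistic_norm_commute)
  then have "((\<lambda>w. u + w - 1 + exp (- logistic_norm \<alpha> ?a (- ln (1 - w)))) has_real_derivative
     1 - exp (- logistic_norm \<alpha> ?a ?b) * logistic_slope \<alpha> ?b ?a / (1 - v)) (at v)"
    by (auto intro!: derivative_eq_intros)
  then have "(inverted_logistic_copula \<alpha> u has_real_derivative
     1 - exp (- logistic_norm \<alpha> ?a ?b) * logistic_slope \<alpha> ?b ?a / (1 - v)) (at v)"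
    by (rule has_field_derivative_transform_within_open[of _ _ _ "{0<..<1}"])
      (use assms inverted_logistic_copula_eq in auto)
  then show ?thesis unfolding cond_fst_def by (rule DERIV_imp_deriv)
qed

text \<open>The logarithm of the density below. It is given as a sum so that each term can be
  divided by \<open>t\<close> separately when the arguments grow with \<open>t\<close>.\<close>

definition logistic_log_density :: "real \<Rightarrow> real \<Rightarrow> real \<Rightarrow> real" where
  "logistic_log_density \<alpha> a b = a + b - logistic_norm \<alpha> a b + (1/\<alpha> - 1) * (ln a + ln b) +
     (1 - 2/\<alpha>) * ln (logistic_norm \<alpha> a b) + ln (logistic_norm \<alpha> a b + (1 - \<alpha>) / \<alpha>)"

text \<open>Differentiating \<open>exp (-N) * \<partial>\<^sub>b N\<close> in \<open>a\<close> gives the product of the two slopes and the mixed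
  second derivative. Both contain the factor \<open>(a * b) powr (1/\<alpha> - 1) * N powr (1 - 2/\<alpha>)\<close>, and what
  remains is \<open>N + (1 - \<alpha>) / \<alpha>\<close>. Hence the density is positive, with an explicit logarithm.\<close>

lemma copula_density_inverted_logistic:
  assumes "\<alpha> \<in> {0<..<1}" "0 < a" "0 < b"
  shows "copula_density (inverted_logistic_copula \<alpha>) (1 - exp (- a)) (1 - exp (- b)) =
    exp (logistic_log_density \<alpha> a b)"
proof -
  define u where "u = 1 - exp (- a)"
  define v where "v = 1 - exp (- b)"
  define N where "N = logistic_norm \<alpha> a b"
  define P where "P = a powr (1/\<alpha> - 1) * b powr (1/\<alpha> - 1)"
  have uv: "u \<in> {0<..<1}" "v \<in> {0<..<1}" using assms by (auto simp: u_def v_def)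
  have ab: "- ln (1 - u) = a" "- ln (1 - v) = b" "1 - u = exp (- a)" "1 - v = exp (- b)"
    by (auto simp: u_def v_def)
  have N: "N > 0" using assms logistic_norm_pos N_def by auto
  have div_exp: "c / exp (- b) = c * exp b" for c
    by (simp add: exp_minus field_simps)
  have w: "((\<lambda>w. - ln (1 - w)) has_real_derivative exp a) (at u)"
    using uv by (auto intro!: derivative_eq_intros simp: ab(3) exp_minus field_simps)
  have cond: "deriv (inverted_logistic_copula \<alpha> w) v =
      1 - exp (- logistic_norm \<alpha> (- ln (1 - w)) b) * logistic_slope \<alpha> b (- ln (1 - w)) * exp b"
    if "w \<in> {0<..<1}" for w
    using cond_fst_inverted_logistic[OF _ that uv(2), of \<alpha>] assms
    by (simp add: cond_fst_def ab(4) div_exp)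
  have slopes: "logistic_slope \<alpha> a b * logistic_slope \<alpha> b a = P * N powr (1 - 2/\<alpha>) * N"
  proof -
    have "N powr (1 - 2/\<alpha>) * N = N powr (1 - 2/\<alpha> + 1)" using N by (simp only: powr_add powr_one)
    also have "\<dots> = (a powr (1/\<alpha>) + b powr (1/\<alpha>)) powr (\<alpha> - 1 + (\<alpha> - 1))"
      using assms by (simp add: N_def logistic_norm_def powr_powr algebra_simps)
    finally show ?thesis unfolding powr_add
      by (simp add: logistic_slope_def P_def add.commute)
  qed
  have "((\<lambda>w. logistic_norm \<alpha> (- ln (1 - w)) b) has_real_derivative logistic_slope \<alpha> a b * exp a) (at u)"
    using DERIV_chain2[OF has_real_derivative_logistic_norm w] ab(1) assms by auto
  moreover have "((\<lambda>w. logistic_slope \<alpha> b (- ln (1 - w))) has_real_derivative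
      - ((1 - \<alpha>) / \<alpha> * (P * N powr (1 - 2/\<alpha>))) * exp a) (at u)"
    using DERIV_chain2[OF has_real_derivative_logistic_slope w] ab(1) assms by (auto simp: P_def N_def)
  ultimately have "((\<lambda>w. 1 - exp (- logistic_norm \<alpha> (- ln (1 - w)) b) * logistic_slope \<alpha> b (- ln (1 - w)) * exp b)
     has_real_derivative exp (- N) * (logistic_slope \<alpha> a b * logistic_slope \<alpha> b a) * exp a * exp b
       + exp (- N) * ((1 - \<alpha>) / \<alpha> * (P * N powr (1 - 2/\<alpha>))) * exp a * exp b) (at u)"
    by (auto intro!: derivative_eq_intros simp: ab(1) N_def algebra_simps)
  also have "exp (- N) * (logistic_slope \<alpha> a b * logistic_slope \<alpha> b a) * exp a * exp b
       + exp (- N) * ((1 - \<alpha>) / \<alpha> * (P * N powr (1 - 2/\<alpha>))) * exp a * exp b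
     = exp (a + b - N) * P * N powr (1 - 2/\<alpha>) * (N + (1 - \<alpha>) / \<alpha>)"
    unfolding slopes by (simp add: exp_add exp_diff exp_minus divide_inverse algebra_simps)
  also have "\<dots> = exp (logistic_log_density \<alpha> a b)"
  proof -
    have "N + (1 - \<alpha>) / \<alpha> > 0" using N assms by (simp add: add_pos_pos)
    then show ?thesis using assms N
      by (simp add: logistic_log_density_def P_def powr_def exp_add N_def[symmetric] distrib_left)
  qed
  finally have "((\<lambda>w. 1 - exp (- logistic_norm \<alpha> (- ln (1 - w)) b) * logistic_slope \<alpha> b (- ln (1 - w)) * exp b)
     has_real_derivative exp (logistic_log_density \<alpha> a b)) (at u)" .
  then have "((\<lambda>w. deriv (inverted_logistic_copula \<alpha> w) v)
     has_real_derivative exp (logistic_log_density \<alpha> a b)) (at u)"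
    by (rule has_field_derivative_transform_within_open[of _ _ _ "{0<..<1}"])
      (use uv cond in auto)
  then show ?thesis
    unfolding copula_density_def u_def v_def by (rule DERIV_imp_deriv)
qed

text \<open>The exponential coordinate of the conditional distribution function of the first
  variable given the second: \<open>-ln (1 - p)\<close> for the conditional probability \<open>p\<close>.\<close>

definition logistic_cond_exp :: "real \<Rightarrow> real \<Rightarrow> real \<Rightarrow> real" where
  "logistic_cond_exp \<alpha> a b = logistic_norm \<alpha> a b - b - ln (logistic_slope \<alpha> b a)"

lemma cond_fst_inverted_logistic_exp:
  assumes "\<alpha> \<in> {0<..<1}" "0 < a" "0 < b"
  shows "cond_fst (inverted_logistic_copula \<alpha>) (1 - exp (- a)) (1 - exp (- b)) =
    1 - exp (- logistic_cond_exp \<alpha> a b)"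
proof -
  have "exp (- logistic_cond_exp \<alpha> a b) = exp (- logistic_norm \<alpha> a b) * logistic_slope \<alpha> b a / exp (- b)"
    using logistic_slope_pos[of b a \<alpha>] assms
    by (simp add: logistic_cond_exp_def exp_add exp_diff exp_minus field_simps)
  then show ?thesis using assms by (subst cond_fst_inverted_logistic) auto
qed

lemma cond_snd_inverted_logistic:
  "cond_snd (inverted_logistic_copula \<alpha>) u v = cond_fst (inverted_logistic_copula \<alpha>) v u"
  unfolding cond_fst_def cond_snd_def by (subst inverted_logistic_copula_commute) simp

lemma logistic_cond_exp_pos:
  assumes "\<alpha> \<in> {0<..<1}" "0 < a" "0 < b"
  shows "0 < logistic_cond_exp \<alpha> a b"
proof -
  have "ln (logistic_slope \<alpha> b a) < 0"
    using logistic_slope_pos[of b a \<alpha>] logistic_slope_less_1[of \<alpha> b a] assms by simp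
  then show ?thesis
    using logistic_norm_gt_snd[of \<alpha> a b] assms by (simp add: logistic_cond_exp_def)
qed

section \<open>Growth rates along rays\<close>

lemma tendsto_ln_over_t:
  fixes F :: "real \<Rightarrow> real"
  assumes "((\<lambda>t. F t / t) \<longlongrightarrow> L) at_top" "L > 0"
  shows "((\<lambda>t. ln (F t) / t) \<longlongrightarrow> 0) at_top"
proof -
  have "((\<lambda>t. ln (F t / t)) \<longlongrightarrow> ln L) at_top"
    using tendsto_ln[OF assms(1)] assms(2) by simp
  then have "((\<lambda>t. ln (F t / t) * (1 / t) + ln t / t) \<longlongrightarrow> ln L * 0 + 0) at_top"
    by (intro tendsto_add tendsto_mult ln_x_over_x_tendsto_0 tendsto_divide_0[OF tendsto_const]
        filterlim_at_top_imp_at_infinity filterlim_ident)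
  moreover have "\<forall>\<^sub>F t in at_top. F t / t > 0"
    using assms by (rule order_tendstoD)
  then have "\<forall>\<^sub>F t in at_top. ln (F t / t) * (1 / t) + ln t / t = ln (F t) / t"
    using eventually_gt_at_top[of 0]
  proof eventually_elim
    case (elim t)
    then have "F t > 0" by (simp add: zero_less_divide_iff)
    then show ?case using elim by (simp add: ln_div field_simps)
  qed
  ultimately show ?thesis by (simp cong: filterlim_cong add: tendsto_cong)
qed

text \<open>The arguments are only required to grow linearly in the limit, rather than to be exact
  multiples of \<open>t\<close>: the conditional copula is evaluated at \<open>logistic_cond_exp\<close>, which is not
  homogeneous.\<close>

lemma logistic_log_density_rate:
  assumes "\<alpha> \<in> {0<..<1}" "0 < a" "0 < b"
    and A: "((\<lambda>t. A t / t) \<longlongrightarrow> a) at_top" and B: "((\<lambda>t. B t / t) \<longlongrightarrow> b) at_top"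
  shows "((\<lambda>t. logistic_log_density \<alpha> (A t) (B t) / t) \<longlongrightarrow> a + b - logistic_norm \<alpha> a b) at_top"
proof -
  have ev: "\<forall>\<^sub>F t in at_top. A t / t > 0" "\<forall>\<^sub>F t in at_top. B t / t > 0"
    using order_tendstoD(1)[OF A] order_tendstoD(1)[OF B] assms by auto
  have "\<forall>\<^sub>F t in at_top. logistic_norm \<alpha> (A t / t) (B t / t) = logistic_norm \<alpha> (A t) (B t) / t"
    using ev eventually_gt_at_top[of 0]
  proof eventually_elim
    case (elim t)
    then show ?case
      using logistic_norm_scale[of \<alpha> t "A t / t" "B t / t"] assms by (simp add: field_simps)
  qed
  then have N: "((\<lambda>t. logistic_norm \<alpha> (A t) (B t) / t) \<longlongrightarrow> logistic_norm \<alpha> a b) at_top"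
    using tendsto_logistic_norm[OF _ assms(2,3) A B, of \<alpha>] assms(1) by (simp add: tendsto_cong)
  have Npos: "logistic_norm \<alpha> a b > 0" using assms logistic_norm_pos by auto
  have "((\<lambda>t. (1 - \<alpha>) / \<alpha> / t) \<longlongrightarrow> 0) at_top"
    by (intro tendsto_divide_0[OF tendsto_const] filterlim_at_top_imp_at_infinity filterlim_ident)
  from tendsto_add[OF N this]
  have N': "((\<lambda>t. (logistic_norm \<alpha> (A t) (B t) + (1 - \<alpha>) / \<alpha>) / t) \<longlongrightarrow> logistic_norm \<alpha> a b) at_top"
    by (simp add: add_divide_distrib)
  note lims = A B N tendsto_ln_over_t[OF A assms(2)] tendsto_ln_over_t[OF B assms(3)]
    tendsto_ln_over_t[OF N Npos] tendsto_ln_over_t[OF N' Npos]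
  have "((\<lambda>t. A t / t + B t / t - logistic_norm \<alpha> (A t) (B t) / t +
       (1/\<alpha> - 1) * (ln (A t) / t + ln (B t) / t) +
       (1 - 2/\<alpha>) * (ln (logistic_norm \<alpha> (A t) (B t)) / t) +
       ln (logistic_norm \<alpha> (A t) (B t) + (1 - \<alpha>) / \<alpha>) / t)
     \<longlongrightarrow> a + b - logistic_norm \<alpha> a b + (1/\<alpha> - 1) * (0 + 0) + (1 - 2/\<alpha>) * 0 + 0) at_top"
    by (intro tendsto_add tendsto_diff tendsto_mult_left lims)
  also have "(\<lambda>t. A t / t + B t / t - logistic_norm \<alpha> (A t) (B t) / t +
       (1/\<alpha> - 1) * (ln (A t) / t + ln (B t) / t) +
       (1 - 2/\<alpha>) * (ln (logistic_norm \<alpha> (A t) (B t)) / t) +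
       ln (logistic_norm \<alpha> (A t) (B t) + (1 - \<alpha>) / \<alpha>) / t) =
     (\<lambda>t. logistic_log_density \<alpha> (A t) (B t) / t)"
    unfolding logistic_log_density_def
    by (simp only: add_divide_distrib diff_divide_distrib times_divide_eq_right distrib_left)
  finally show ?thesis by simp
qed

text \<open>The slope is homogeneous of order 0, so its logarithm stays constant along the ray.\<close>

lemma logistic_cond_exp_rate:
  assumes "\<alpha> > 0" "0 < a" "0 < b"
  shows "((\<lambda>t. logistic_cond_exp \<alpha> (t * a) (t * b) / t) \<longlongrightarrow> logistic_norm \<alpha> a b - b) at_top"
proof -
  have "((\<lambda>t. logistic_norm \<alpha> a b - b - ln (logistic_slope \<alpha> b a) / t) \<longlongrightarrow> logistic_norm \<alpha> a b - b - 0) at_top"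
    by (intro tendsto_diff tendsto_const tendsto_divide_0[OF tendsto_const]
        filterlim_at_top_imp_at_infinity filterlim_ident)
  moreover have "\<forall>\<^sub>F t in at_top. logistic_norm \<alpha> a b - b - ln (logistic_slope \<alpha> b a) / t =
     logistic_cond_exp \<alpha> (t * a) (t * b) / t"
    using eventually_gt_at_top[of 0]
  proof eventually_elim
    case (elim t)
    then have "logistic_cond_exp \<alpha> (t * a) (t * b) =
        t * (logistic_norm \<alpha> a b - b) - ln (logistic_slope \<alpha> b a)"
      using assms
      by (simp add: logistic_cond_exp_def logistic_norm_scale logistic_slope_scale right_diff_distrib)
    then show ?case using elim by (simp add: diff_divide_distrib)
  qed
  ultimately show ?thesis by (simp add: tendsto_cong)
qed

lemma vine_density_eq:
  fixes x :: "real^3"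
  assumes "\<alpha> \<in> {0<..<1}" "\<beta> \<in> {0<..<1}" "\<gamma> \<in> {0<..<1}" "\<forall>i. 0 < x $ i"
  shows "exp_margins_density (vine_copula_density (inverted_logistic_copula \<alpha>)
          (inverted_logistic_copula \<beta>) (inverted_logistic_copula \<gamma>)) x =
    exp (logistic_log_density \<alpha> (x $ 1) (x $ 2) + logistic_log_density \<beta> (x $ 2) (x $ 3) +
      logistic_log_density \<gamma> (logistic_cond_exp \<alpha> (x $ 1) (x $ 2)) (logistic_cond_exp \<beta> (x $ 3) (x $ 2)) -
      (x $ 1 + x $ 2 + x $ 3))"
    (is "_ = exp (?p + ?q + ?r - ?s)")
proof -
  have "exp (?p + ?q + ?r - ?s) = exp ?p * exp ?q * exp ?r * (exp (- x $ 1) * exp (- x $ 2) * exp (- x $ 3))"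
    by (simp add: exp_add[symmetric])
  then show ?thesis
    using assms
    by (simp add: exp_margins_density_def vine_copula_density_def cond_snd_inverted_logistic
        cond_fst_inverted_logistic_exp copula_density_inverted_logistic logistic_cond_exp_pos)
qed

text \<open>The rates of \<open>C\<^sub>1\<^sub>2\<close>, \<open>C\<^sub>2\<^sub>3\<close> and the margins add up to \<open>a + b + x\<^sub>2\<close>, and that of the
  conditional copula is \<open>N\<^sub>\<gamma>(a, b) - a - b\<close>.\<close>

lemma vine_log_density_rate:
  fixes x :: "real^3"
  assumes par: "\<alpha> \<in> {0<..<1}" "\<beta> \<in> {0<..<1}" "\<gamma> \<in> {0<..<1}" and x: "\<forall>i. 0 < x $ i"
  defines "f \<equiv> exp_margins_density (vine_copula_density (inverted_logistic_copula \<alpha>)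
          (inverted_logistic_copula \<beta>) (inverted_logistic_copula \<gamma>))"
  shows "((\<lambda>t. - ln (f (t *\<^sub>R x)) / t) \<longlongrightarrow>
    x $ 2 + logistic_norm \<gamma> (logistic_norm \<alpha> (x $ 1) (x $ 2) - x $ 2)
                           (logistic_norm \<beta> (x $ 2) (x $ 3) - x $ 2)) at_top"
proof -
  define A where "A = (\<lambda>t. logistic_cond_exp \<alpha> (t * x $ 1) (t * x $ 2))"
  define B where "B = (\<lambda>t. logistic_cond_exp \<beta> (t * x $ 3) (t * x $ 2))"
  define a where "a = logistic_norm \<alpha> (x $ 1) (x $ 2) - x $ 2"
  define b where "b = logistic_norm \<beta> (x $ 3) (x $ 2) - x $ 2"
  have lin: "((\<lambda>t. t * c / t) \<longlongrightarrow> c) at_top" for c :: real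
    by (rule tendsto_eventually) (use eventually_gt_at_top[of 0] in eventually_elim, simp)
  have ab: "a > 0" "b > 0"
    using par x logistic_norm_gt_snd by (auto simp: a_def b_def)
  have "((\<lambda>t. - (logistic_log_density \<alpha> (t * x $ 1) (t * x $ 2) / t)
      - logistic_log_density \<beta> (t * x $ 2) (t * x $ 3) / t
      - logistic_log_density \<gamma> (A t) (B t) / t + (x $ 1 + x $ 2 + x $ 3)) \<longlongrightarrow>
      - (x $ 1 + x $ 2 - logistic_norm \<alpha> (x $ 1) (x $ 2))
      - (x $ 2 + x $ 3 - logistic_norm \<beta> (x $ 2) (x $ 3))
      - (a + b - logistic_norm \<gamma> a b) + (x $ 1 + x $ 2 + x $ 3)) at_top"
    by (intro tendsto_add tendsto_diff tendsto_minus tendsto_const logistic_log_density_rate lin par ab)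
      (use par x in \<open>auto simp: A_def B_def a_def b_def intro!: logistic_cond_exp_rate\<close>)
  moreover have "\<forall>\<^sub>F t in at_top. - (logistic_log_density \<alpha> (t * x $ 1) (t * x $ 2) / t)
      - logistic_log_density \<beta> (t * x $ 2) (t * x $ 3) / t
      - logistic_log_density \<gamma> (A t) (B t) / t + (x $ 1 + x $ 2 + x $ 3) = - ln (f (t *\<^sub>R x)) / t"
    using eventually_gt_at_top[of 0]
  proof eventually_elim
    case (elim t)
    then have "\<forall>i. 0 < (t *\<^sub>R x) $ i" using x by simp
    from vine_density_eq[OF par this] show ?case
      using elim by (simp add: f_def A_def B_def field_simps)
  qed
  ultimately have "((\<lambda>t. - ln (f (t *\<^sub>R x)) / t) \<longlongrightarrow>
      - (x $ 1 + x $ 2 - logistic_norm \<alpha> (x $ 1) (x $ 2))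
      - (x $ 2 + x $ 3 - logistic_norm \<beta> (x $ 2) (x $ 3))
      - (a + b - logistic_norm \<gamma> a b) + (x $ 1 + x $ 2 + x $ 3)) at_top"
    by (rule Lim_transform_eventually)
  then show ?thesis
    by (simp add: a_def b_def logistic_norm_commute[of \<beta> "x $ 3"] algebra_simps)
qed

section \<open>The coefficient of tail dependence\<close>

theorem mainTheorem3:
  fixes \<alpha> \<beta> \<gamma> :: real and g :: "real^3 \<Rightarrow> real"
  assumes "\<alpha> \<in> {0<..<1}" and "\<beta> \<in> {0<..<1}" and "\<gamma> \<in> {0<..<1}"
    and "\<And>x. (\<forall>i. 0 \<le> x $ i) \<Longrightarrow>
      g x = x $ 2 +
        (((x $ 1 powr (1/\<alpha>) + x $ 2 powr (1/\<alpha>)) powr \<alpha> - x $ 2) powr (1/\<gamma>) +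
         ((x $ 2 powr (1/\<beta>) + x $ 3 powr (1/\<beta>)) powr \<beta> - x $ 2) powr (1/\<gamma>)) powr \<gamma>"
  shows "is_gauge_function
      (exp_margins_density
        (vine_copula_density (inverted_logistic_copula \<alpha>)
          (inverted_logistic_copula \<beta>) (inverted_logistic_copula \<gamma>))) g \<and>
    is_arg_min g (\<lambda>x. (MIN i. x $ i) \<ge> 1) (vector [1, 1, 1]) \<and>
    tail_dependence_coeff g = inverse (g (vector [1, 1, 1])) \<and>
    inverse (g (vector [1, 1, 1])) =
      inverse (1 + ((2 powr \<alpha> - 1) powr (1/\<gamma>) + (2 powr \<beta> - 1) powr (1/\<gamma>)) powr \<gamma>)"
proof -
  note par = assms(1-3)
  let ?f = "exp_margins_density (vine_copula_density (inverted_logistic_copula \<alpha>)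
          (inverted_logistic_copula \<beta>) (inverted_logistic_copula \<gamma>))"
  let ?A = "\<lambda>x::real^3. logistic_norm \<alpha> (x $ 1) (x $ 2) - x $ 2"
  let ?B = "\<lambda>x::real^3. logistic_norm \<beta> (x $ 2) (x $ 3) - x $ 2"
  have g: "g x = x $ 2 + logistic_norm \<gamma> (?A x) (?B x)" if "\<forall>i. 0 \<le> x $ i" for x
    using assms(4)[OF that] by (simp add: logistic_norm_def)
  have AB: "?A x \<ge> 0" "?B x \<ge> 0" if "\<forall>i. 0 \<le> x $ i" for x
    using logistic_norm_ge_snd[of \<alpha> "x $ 1" "x $ 2"] logistic_norm_ge_snd[of \<beta> "x $ 3" "x $ 2"] that par
    by (auto simp: logistic_norm_commute[of \<beta> "x $ 2"])
  \<comment> \<open>On the boundary of the orthant the bases of the powers may vanish; the powers are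
    continuous there because their exponents are positive.\<close>
  have norm_cont: "continuous_on {x::real^3. \<forall>i. 0 \<le> x $ i} (\<lambda>x. logistic_norm \<delta> (F x) (G x))"
    if "\<delta> \<in> {0<..<1}" "continuous_on {x. \<forall>i. 0 \<le> x $ i} F" "continuous_on {x. \<forall>i. 0 \<le> x $ i} G"
      "\<And>x. \<forall>i. 0 \<le> x $ i \<Longrightarrow> 0 \<le> F x" "\<And>x. \<forall>i. 0 \<le> x $ i \<Longrightarrow> 0 \<le> G x" for \<delta> F G
    unfolding logistic_norm_def using that
    by (intro continuous_on_powr' continuous_on_add continuous_on_const) auto
  have "continuous_on {x::real^3. \<forall>i. 0 \<le> x $ i} (\<lambda>x. x $ 2 + logistic_norm \<gamma> (?A x) (?B x))"
    using par AB by (intro continuous_intros norm_cont) auto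
  then have cont: "continuous_on {x. \<forall>i. 0 \<le> x $ i} g"
    by (rule continuous_on_eq) (simp add: g)
  have hom: "g (t *\<^sub>R x) = t * g x" if x: "\<forall>i. 0 \<le> x $ i" and t: "0 < t" for x t
  proof -
    have "?A (t *\<^sub>R x) = t * ?A x" "?B (t *\<^sub>R x) = t * ?B x"
      using x t par by (simp_all add: logistic_norm_scale right_diff_distrib)
    moreover have "\<forall>i. 0 \<le> (t *\<^sub>R x) $ i" using x t by simp
    ultimately have "g (t *\<^sub>R x) = t * x $ 2 + logistic_norm \<gamma> (t * ?A x) (t * ?B x)"
      using g by simp
    then show ?thesis
      using g[OF x] AB[OF x] t par by (simp add: logistic_norm_scale distrib_left)
  qed
  have asym: "(\<forall>\<^sub>F t in at_top. 0 < ?f (t *\<^sub>R x)) \<and> (\<lambda>t. - ln (?f (t *\<^sub>R x))) \<sim>[at_top] (\<lambda>t. t * g x)"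
    if x: "\<forall>i. 0 < x $ i" for x
  proof
    have x': "\<forall>i. 0 \<le> x $ i" using x less_imp_le by blast
    show "\<forall>\<^sub>F t in at_top. 0 < ?f (t *\<^sub>R x)"
      using eventually_gt_at_top[of 0]
    proof eventually_elim
      case (elim t)
      then have "\<forall>i. 0 < (t *\<^sub>R x) $ i" using x by simp
      from vine_density_eq[OF par this] show ?case by simp
    qed
    have "logistic_norm \<gamma> (?A x) (?B x) \<ge> 0" by (simp add: logistic_norm_def)
    then have gpos: "g x > 0" using g[OF x'] x by (simp add: add_pos_nonneg)
    have "((\<lambda>t. - ln (?f (t *\<^sub>R x)) / t / g x) \<longlongrightarrow> g x / g x) at_top"
      using vine_log_density_rate[OF par x] gpos g[OF x'] by (intro tendsto_divide tendsto_const) auto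
    then show "(\<lambda>t. - ln (?f (t *\<^sub>R x))) \<sim>[at_top] (\<lambda>t. t * g x)"
      using gpos by (intro asymp_equivI') simp
  qed
  have Min_iff: "(MIN i. x $ i) \<ge> 1 \<longleftrightarrow> (\<forall>i. 1 \<le> x $ i)" for x :: "real^3"
    by (subst Min_ge_iff) auto
  let ?e = "vector [1, 1, 1] :: real^3"
  have e: "\<forall>i. ?e $ i = 1" by (simp add: forall_3)
  have ge: "g ?e = 1 + logistic_norm \<gamma> (2 powr \<alpha> - 1) (2 powr \<beta> - 1)"
    using g[of ?e] e by (simp add: logistic_norm_1_1)
  have lower: "g ?e \<le> g x" if x: "\<forall>i. 1 \<le> x $ i" for x
  proof -
    have "\<forall>i. 0 \<le> x $ i" using x by (meson order_trans zero_le_one)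
    from g[OF this] show ?thesis
      using gauge_min_bound[OF par, of "x $ 1" "x $ 2" "x $ 3"] x ge
      by (simp add: logistic_norm_commute[of \<beta> "x $ 2"])
  qed
  have "(LEAST m. m \<in> g ` {x. (MIN i. x $ i) \<ge> 1}) = g ?e"
    using e lower by (intro Least_equality) (auto simp: Min_iff)
  then have "tail_dependence_coeff g = inverse (g ?e)"
    by (simp add: tail_dependence_coeff_def)
  moreover have "is_arg_min g (\<lambda>x. (MIN i. x $ i) \<ge> 1) ?e"
    using e lower by (auto simp: is_arg_min_def Min_iff not_less)
  ultimately show ?thesis
    using cont hom asym ge unfolding is_gauge_function_def logistic_norm_def by auto
qed

end
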